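(* Let $U\subset \mathbb{C}^n$ be an open set that is star-shaped with respect to a point $a\in U$, and let $F=(F_1,\dots,F_n):U\to\mathbb{C}^n$ be a holomorphic function. Then $$\frac{\partial F_j}{\partial z_k}(z)=\frac{\partial F_k}{\partial z_j}(z)\qquad\text{for all } z\in U \text{ and all } j,k=1,\dots,n$$ if and only if there exists a holomorphic function $g:U\to\mathbb{C}$ such that $dg=F$ and $g(a)=0$.
   Context: $U$ is star-shaped with respect to $a$ if $a+t(z-a)\in U$ for every $z\in U$ and $t\in[0,1]$. $\partial/\partial z_k$ denotes the complex partial derivative. The differential of a holomorphic function $g:U\to\mathbb{C}$ is identified with the $\mathbb{C}^n$-valued map $dg(z)=\big(\frac{\partial g}{\partial z_1}(z),\dots,\frac{\partial g}{\partial z_n}(z)\big)$. *)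

theory Defs
  imports "HOL-Complex_Analysis.Complex_Analysis"
begin

text \<open>The library's \<open>starlike\<close> leaves the centre existentially quantified; here it is a parameter.\<close>

definition star_shaped_wrt :: "'a::real_vector \<Rightarrow> 'a set \<Rightarrow> bool" where
  "star_shaped_wrt a U \<longleftrightarrow> (\<forall>z\<in>U. \<forall>t\<in>{0..1}. a + t *\<^sub>R (z - a) \<in> U)"

text \<open>
  Holomorphy in several variables: the real Frechet derivative exists at every point and is
  complex linear. Additivity of \<open>D\<close> is part of \<open>has_derivative\<close>, so only
  complex homogeneity has to be required.
\<close>

definition mholomorphic_on :: "(complex ^ 'n \<Rightarrow> complex) \<Rightarrow> (complex ^ 'n) set \<Rightarrow> bool"
    (infixl "mholomorphic'_on" 50) where
  "f mholomorphic_on U \<longleftrightarrow>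
     (\<forall>z\<in>U. \<exists>D. (f has_derivative D) (at z within U) \<and> (\<forall>c v. D (c *s v) = c * D v))"

definition vholomorphic_on :: "(complex ^ 'n \<Rightarrow> complex ^ 'm) \<Rightarrow> (complex ^ 'n) set \<Rightarrow> bool"
    (infixl "vholomorphic'_on" 50) where
  "F vholomorphic_on U \<longleftrightarrow> (\<forall>j. (\<lambda>z. F z $ j) mholomorphic_on U)"

text \<open>
  The complex partial derivative with respect to the \<open>k\<close>-th coordinate. As with
  \<open>deriv\<close>, the value is meaningful only where that derivative exists.
\<close>

definition cpartial :: "'n \<Rightarrow> (complex ^ 'n \<Rightarrow> complex) \<Rightarrow> complex ^ 'n \<Rightarrow> complex" where
  "cpartial k f z = deriv (\<lambda>t. f (z + t *s axis k 1)) 0"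

definition cdifferential :: "(complex ^ 'n \<Rightarrow> complex) \<Rightarrow> complex ^ 'n \<Rightarrow> complex ^ 'n" where
  "cdifferential g z = (\<chi> k. cpartial k g z)"

end

theory Submission
  imports Defs
begin

text \<open>
  On a star-shaped set the only candidate for \<open>g\<close> is the radial integral
  \<open>g(z) = \<integral>\<^sub>0\<^sup>1 \<Sum>\<^sub>j F\<^sub>j(a + t(z - a)) (z\<^sub>j - a\<^sub>j) dt\<close>.
  Differentiating under the integral sign and then using the symmetry of the partial derivatives,
  the coefficient of \<open>dz\<^sub>k\<close> in the integrand becomes
  \<open>F\<^sub>k(p) + t \<Sum>\<^sub>j (z\<^sub>j - a\<^sub>j) \<partial>\<^sub>j F\<^sub>k(p)\<close> with \<open>p = a + t(z - a)\<close>. This is exactly the derivative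
  of \<open>t F\<^sub>k(a + t(z - a))\<close> with respect to \<open>t\<close>, so it integrates to \<open>F\<^sub>k(z)\<close>
  (\<open>has_derivative_radial_integral\<close>).

  Differentiation under the integral uses that the partial derivatives of \<open>F\<close> are continuous,
  whereas holomorphy only provides a complex-linear derivative at each point. Continuity comes from
  one complex variable (\<open>continuous_on_cpartial\<close>): along a coordinate line a holomorphic
  function is an ordinary holomorphic function of one variable, nearby parallel lines give
  uniformly close functions, and locally uniform convergence of holomorphic functions carries over
  to their derivatives.

  The same principle gives the converse. If \<open>F\<^sub>j = \<partial>\<^sub>j g\<close>, the claim is that the mixed second partial
  derivatives of \<open>g\<close> agree (\<open>cpartial_commute\<close>): the difference quotients of \<open>g\<close> in
  direction \<open>k\<close> converge uniformly along a line in direction \<open>j\<close>, hence may be differentiated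
  in direction \<open>j\<close> before passing to the limit.
\<close>

section \<open>Complex-linear derivatives and coordinate lines\<close>

lemma bounded_linear_complex_line: "bounded_linear (\<lambda>t::complex. t *s (v :: complex ^ 'n))"
  by (intro linear_conv_bounded_linear[THEN iffD1] linearI)
     (simp_all add: vec_eq_iff algebra_simps)

lemma norm_complex_line_axis: "norm (t *s axis k 1 :: complex ^ 'n) = norm t"
proof -
  have "(t *s axis k 1 :: complex ^ 'n) = axis k t"
    by (simp add: vec_eq_iff axis_def)
  then show ?thesis
    by (simp add: norm_vec_def axis_def L2_set_def if_distrib[of norm] if_distrib[of "\<lambda>x. x\<^sup>2"]
        cong: if_cong)
qed

text \<open>
  A complex-linear map is determined by its values on the standard basis, and these values are the
  derivatives of the restrictions of \<open>f\<close> to coordinate lines.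
\<close>

lemma mholomorphic_on_has_derivative:
  fixes f :: "complex ^ 'n \<Rightarrow> complex"
  assumes "open U" "f mholomorphic_on U" "z \<in> U"
  shows "(f has_derivative (\<lambda>v. \<Sum>k\<in>UNIV. v $ k * cpartial k f z)) (at z)"
proof -
  obtain D where D: "(f has_derivative D) (at z)" and hom: "\<And>c v. D (c *s v) = c * D v"
    using assms unfolding mholomorphic_on_def by (metis at_within_open)
  have D_axis: "D (axis k 1) = cpartial k f z" for k
  proof -
    have "((\<lambda>t::complex. z + t *s axis k 1) has_derivative (\<lambda>t. t *s axis k 1)) (at 0)"
      by (auto intro!: derivative_eq_intros
            bounded_linear.has_derivative[OF bounded_linear_complex_line])
    from has_derivative_compose[OF this, of f D] D
    have "((\<lambda>t. f (z + t *s axis k 1)) has_field_derivative D (axis k 1)) (at 0)"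
      by (simp add: hom has_field_derivative_def mult_commute_abs)
    then show ?thesis
      by (simp add: cpartial_def DERIV_imp_deriv)
  qed
  have "D v = (\<Sum>k\<in>UNIV. v $ k * cpartial k f z)" for v
  proof -
    have "D v = D (\<Sum>k\<in>UNIV. v $ k *s axis k 1)"
      by (simp add: basis_expansion)
    also have "\<dots> = (\<Sum>k\<in>UNIV. v $ k * cpartial k f z)"
      by (simp add: linear_sum[OF has_derivative_linear[OF D]] hom D_axis)
    finally show ?thesis .
  qed
  then have "D = (\<lambda>v. \<Sum>k\<in>UNIV. v $ k * cpartial k f z)"
    by blast
  with D show ?thesis
    by simp
qed

lemma mholomorphic_onI:
  fixes f :: "complex ^ 'n \<Rightarrow> complex"
  assumes "\<And>z. z \<in> U \<Longrightarrow> (f has_derivative (\<lambda>v. \<Sum>k\<in>UNIV. v $ k * c z k)) (at z)"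
  shows "f mholomorphic_on U"
  unfolding mholomorphic_on_def
proof
  fix z assume "z \<in> U"
  then show "\<exists>D. (f has_derivative D) (at z within U) \<and> (\<forall>b v. D (b *s v) = b * D v)"
    using has_derivative_at_withinI[OF assms]
    by (intro exI[of _ "\<lambda>v. \<Sum>k\<in>UNIV. v $ k * c z k"])
       (auto simp: sum_distrib_left mult.assoc)
qed

lemma has_field_derivative_coordinate_line:
  fixes f :: "complex ^ 'n \<Rightarrow> complex"
  assumes f: "(f has_derivative (\<lambda>v. \<Sum>k\<in>UNIV. v $ k * c k)) (at (z + t *s axis j 1))"
  shows "((\<lambda>t. f (z + t *s axis j 1)) has_field_derivative c j) (at t)"
proof -
  have "((\<lambda>t::complex. z + t *s axis j 1) has_derivative (\<lambda>t. t *s axis j 1)) (at t)"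
    by (auto intro!: derivative_eq_intros
          bounded_linear.has_derivative[OF bounded_linear_complex_line])
  from has_derivative_compose[OF this f]
  show ?thesis
    by (simp add: has_field_derivative_def axis_def if_distrib if_distribR mult_commute_abs
          cong: if_cong)
qed

lemma cpartial_eqI:
  fixes f :: "complex ^ 'n \<Rightarrow> complex"
  assumes "(f has_derivative (\<lambda>v. \<Sum>k\<in>UNIV. v $ k * c k)) (at z)"
  shows "cpartial j f z = c j"
  using has_field_derivative_coordinate_line[of f c z 0 j] assms
  by (simp add: cpartial_def DERIV_imp_deriv)

lemma has_field_derivative_cpartial:
  fixes f :: "complex ^ 'n \<Rightarrow> complex"
  assumes "open U" "f mholomorphic_on U" "z + t *s axis j 1 \<in> U"
  shows "((\<lambda>t. f (z + t *s axis j 1)) has_field_derivative cpartial j f (z + t *s axis j 1)) (at t)"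
  using has_field_derivative_coordinate_line mholomorphic_on_has_derivative[OF assms] .

lemma mholomorphic_on_imp_continuous_on:
  assumes "f mholomorphic_on U"
  shows "continuous_on U f"
  using assms unfolding mholomorphic_on_def continuous_on_eq_continuous_within
  by (metis has_derivative_continuous)

text \<open>Partial derivatives are local, since an open set contains a piece of each coordinate line.\<close>

lemma cpartial_cong:
  assumes "open U" "z \<in> U" and eq: "\<And>w. w \<in> U \<Longrightarrow> f w = g w"
  shows "cpartial k f z = cpartial k g z"
proof -
  have "((\<lambda>t. z + t *s axis k 1) \<longlongrightarrow> z + 0 *s axis k 1) (nhds 0)"
    using bounded_linear.isCont[OF bounded_linear_complex_line[of "axis k 1"] continuous_ident, of 0]
    by (intro tendsto_intros) (simp add: isCont_def tendsto_nhds_iff)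
  then have "\<forall>\<^sub>F t in nhds 0. z + t *s axis k 1 \<in> U"
    using topological_tendstoD[of _ _ _ U] assms by simp
  then have "\<forall>\<^sub>F t in nhds 0. f (z + t *s axis k 1) = g (z + t *s axis k 1)"
    by (rule eventually_mono) (rule eq)
  then show ?thesis
    unfolding cpartial_def by (rule deriv_cong_ev) simp
qed

section \<open>Regularity and symmetry of partial derivatives\<close>

text \<open>
  As \<open>w\<close> tends to \<open>z\<close>, uniform continuity of \<open>f\<close> on a compact ball makes the one-variable
  functions \<open>s \<mapsto> f(w + s e\<^sub>k)\<close> converge uniformly to \<open>s \<mapsto> f(z + s e\<^sub>k)\<close> on a disc. By
  Weierstrass's theorem their derivatives at \<open>0\<close> converge as well.
\<close>

lemma continuous_on_cpartial:
  fixes f :: "complex ^ 'n \<Rightarrow> complex"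
  assumes U: "open U" and f: "f mholomorphic_on U"
  shows "continuous_on U (cpartial k f)"
  unfolding continuous_on_def
proof
  fix z assume "z \<in> U"
  then obtain R where R: "R > 0" "cball z R \<subseteq> U"
    using U by (meson open_contains_cball)
  \<comment> \<open>Two displacements of length at most \<open>R / 2\<close> stay within the ball of radius \<open>R\<close>.\<close>
  define r where "r = R / 2"
  have r: "r > 0" "R = r + r"
    using R by (simp_all add: r_def)
  have mem: "w + s *s axis k 1 \<in> cball z R" if "dist w z \<le> r" "norm s \<le> r" for w and s :: complex
  proof -
    have "dist z (w + s *s axis k 1) \<le> dist z w + norm (s *s axis k 1 :: complex ^ 'n)"
      using norm_triangle_ineq4[of "z - w" "s *s axis k 1"] by (simp add: dist_norm diff_diff_add)
    then show ?thesis
      using that r by (simp add: norm_complex_line_axis dist_commute)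
  qed
  have unif: "uniformly_continuous_on (cball z R) f"
    using mholomorphic_on_imp_continuous_on[OF f] R
    by (intro compact_uniformly_continuous) (auto intro: continuous_on_subset)
  have near: "\<forall>\<^sub>F w in at z within U. dist w z < d" if "d > 0" for d
    using that unfolding eventually_at by auto
  have "uniform_limit (ball 0 r) (\<lambda>w s. f (w + s *s axis k 1)) (\<lambda>s. f (z + s *s axis k 1))
          (at z within U)"
  proof (rule uniform_limitI)
    fix e :: real assume "e > 0"
    then obtain d where d: "d > 0"
      "\<And>x y. x \<in> cball z R \<Longrightarrow> y \<in> cball z R \<Longrightarrow> dist y x < d \<Longrightarrow> dist (f y) (f x) < e"
      using uniformly_continuous_onE[OF unif, of e] by blast
    show "\<forall>\<^sub>F w in at z within U. \<forall>s\<in>ball 0 r.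
            dist (f (w + s *s axis k 1)) (f (z + s *s axis k 1)) < e"
      using near[of "min d r"] d(1) r(1)
      by (simp, elim eventually_mono) (auto intro!: d(2) mem)
  qed
  moreover have "\<forall>\<^sub>F w in at z within U. (\<lambda>s. f (w + s *s axis k 1)) holomorphic_on ball 0 r"
    using near[OF r(1)]
  proof (rule eventually_mono)
    fix w assume "dist w z < r"
    then show "(\<lambda>s. f (w + s *s axis k 1)) holomorphic_on ball 0 r"
      using mem R(2)
      by (auto simp: holomorphic_on_open subset_iff
          intro!: exI has_field_derivative_cpartial[OF U f])
  qed
  moreover have "at z within U \<noteq> bot"
    using U \<open>z \<in> U\<close> by (simp add: at_within_open[OF _ U])
  ultimately have "((\<lambda>w. (deriv ^^ 1) (\<lambda>s. f (w + s *s axis k 1)) 0) \<longlongrightarrow>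
      (deriv ^^ 1) (\<lambda>s. f (z + s *s axis k 1)) 0) (at z within U)"
    by (rule higher_deriv_complex_uniform_limit) (use r in auto)
  then show "(cpartial k f \<longlongrightarrow> cpartial k f z) (at z within U)"
    by (simp add: cpartial_def[abs_def])
qed

text \<open>
  Let \<open>Q\<^sub>t(s) = (f(z + s e\<^sub>j + t e\<^sub>k) - f(z + s e\<^sub>j)) / t\<close>. By the mean value inequality and the uniform
  continuity of \<open>\<partial>\<^sub>k f\<close>, these functions of \<open>s\<close> converge uniformly to \<open>\<partial>\<^sub>k f(z + s e\<^sub>j)\<close> as
  \<open>t\<close> tends to \<open>0\<close>, so their derivatives at \<open>s = 0\<close> tend to \<open>\<partial>\<^sub>j \<partial>\<^sub>k f(z)\<close>. But the derivative of
  \<open>Q\<^sub>t\<close> at \<open>0\<close> is the difference quotient of \<open>\<partial>\<^sub>j f\<close> in direction \<open>k\<close>, whose limit is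
  \<open>\<partial>\<^sub>k \<partial>\<^sub>j f(z)\<close>. Convergence of the derivatives of \<open>Q\<^sub>t\<close> thus shows
  both that this limit exists and what it is.
\<close>

lemma cpartial_commute:
  fixes f :: "complex ^ 'n \<Rightarrow> complex"
  assumes U: "open U" and f: "f mholomorphic_on U" and "z \<in> U"
  shows "cpartial k (cpartial j f) z = cpartial j (cpartial k f) z"
proof -
  obtain R where R: "R > 0" "cball z R \<subseteq> U"
    using U \<open>z \<in> U\<close> by (meson open_contains_cball)
  \<comment> \<open>Two displacements of length at most \<open>R / 2\<close> stay within the ball of radius \<open>R\<close>.\<close>
  define r where "r = R / 2"
  have r: "r > 0" "R = r + r"
    using R by (simp_all add: r_def)
  have mem: "z + s *s axis j 1 + t *s axis k 1 \<in> cball z R" if "norm s \<le> r" "norm t \<le> r"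
    for s t :: complex
  proof -
    have "dist z (z + s *s axis j 1 + t *s axis k 1)
        = norm (s *s axis j 1 + t *s axis k 1 :: complex ^ 'n)"
      by (metis add.assoc add_diff_cancel_left' dist_commute dist_norm)
    also have "\<dots> \<le> norm s + norm t"
      by (metis norm_triangle_ineq norm_complex_line_axis)
    finally show ?thesis
      using that r by simp
  qed
  have memU: "z + s *s axis j 1 + t *s axis k 1 \<in> U" if "norm s \<le> r" "norm t \<le> r"
    for s t :: complex
    using mem[OF that] R(2) by blast
  have unif: "uniformly_continuous_on (cball z R) (cpartial k f)"
    using continuous_on_cpartial[OF U f] R
    by (intro compact_uniformly_continuous) (auto intro: continuous_on_subset)
  have near: "\<forall>\<^sub>F t in at (0::complex). t \<noteq> 0 \<and> norm t < d" if "d > 0" for d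
    using that unfolding eventually_at by auto
  define Q where "Q t s = (f (z + s *s axis j 1 + t *s axis k 1) - f (z + s *s axis j 1)) / t"
    for s t
  have Q_deriv: "(Q t has_field_derivative
      (cpartial j f (z + s *s axis j 1 + t *s axis k 1) - cpartial j f (z + s *s axis j 1)) / t) (at s)"
    if "norm s \<le> r" "norm t \<le> r" for s t
  proof -
    have "z + t *s axis k 1 + s *s axis j 1 \<in> U" "z + s *s axis j 1 \<in> U"
      using memU[of s t] memU[of s 0] that r(1) by (simp_all add: add_ac)
    from this[THEN has_field_derivative_cpartial[OF U f]]
    show ?thesis
      unfolding Q_def divide_inverse add.assoc add.commute[of "t *s axis k 1"]
      by (intro DERIV_cmult_right DERIV_diff)
  qed
  have "uniform_limit (ball 0 r) Q (\<lambda>s. cpartial k f (z + s *s axis j 1)) (at 0)"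
  proof (rule uniform_limitI)
    fix e :: real assume "e > 0"
    then have "\<exists>d>0. \<forall>x\<in>cball z R. \<forall>y\<in>cball z R. dist y x < d \<longrightarrow>
        dist (cpartial k f y) (cpartial k f x) < e / 2"
      using unif[unfolded uniformly_continuous_on_def, rule_format, of "e / 2"] by simp
    then obtain d where d: "d > 0" "\<And>x y. x \<in> cball z R \<Longrightarrow> y \<in> cball z R \<Longrightarrow> dist y x < d \<Longrightarrow>
        dist (cpartial k f y) (cpartial k f x) < e / 2"
      by blast
    have "dist (Q t s) (cpartial k f (z + s *s axis j 1)) < e"
      if t: "t \<noteq> 0" "norm t < min d r" and s: "norm s < r" for t s
    proof -
      let ?w = "z + s *s axis j 1"
      \<comment> \<open>Subtracting the linear part leaves a function of \<open>\<tau>\<close> with derivative at most \<open>e / 2\<close>.\<close>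
      define h where "h \<tau> = f (?w + \<tau> *s axis k 1) - \<tau> * cpartial k f ?w" for \<tau>
      have "norm (h t - h 0) \<le> e / 2 * norm (t - 0)"
      proof (rule field_differentiable_bound)
        show "convex (cball (0::complex) (norm t))"
          by simp
        fix \<tau> assume \<tau>: "\<tau> \<in> cball (0::complex) (norm t)"
        then have *: "norm \<tau> \<le> r" "norm \<tau> < d"
          using t by auto
        have "((\<lambda>\<tau>. f (?w + \<tau> *s axis k 1)) has_field_derivative cpartial k f (?w + \<tau> *s axis k 1))
                (at \<tau>)"
          using memU[of s \<tau>] * s by (intro has_field_derivative_cpartial[OF U f]) simp
        moreover have "((\<lambda>\<tau>. \<tau> * cpartial k f ?w) has_field_derivative cpartial k f ?w) (at \<tau>)"
          by (auto intro!: derivative_eq_intros)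
        ultimately show "(h has_field_derivative
            cpartial k f (?w + \<tau> *s axis k 1) - cpartial k f ?w) (at \<tau> within cball 0 (norm t))"
          unfolding h_def by (rule has_field_derivative_at_within[OF DERIV_diff])
        have "dist (?w + \<tau> *s axis k 1) ?w < d"
          using * by (simp add: dist_norm norm_complex_line_axis)
        then show "norm (cpartial k f (?w + \<tau> *s axis k 1) - cpartial k f ?w) \<le> e / 2"
          using d(2)[of ?w "?w + \<tau> *s axis k 1"] mem[of s \<tau>] mem[of s 0] * s r(1)
          by (simp add: dist_norm)
      qed auto
      moreover have "Q t s - cpartial k f ?w = (h t - h 0) / t"
        using t by (simp add: Q_def h_def field_simps)
      ultimately have "dist (Q t s) (cpartial k f ?w) \<le> e / 2"
        using t by (simp add: dist_norm norm_divide pos_divide_le_eq)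
      with \<open>e > 0\<close> show ?thesis
        by simp
    qed
    then show "\<forall>\<^sub>F t in at 0. \<forall>s\<in>ball 0 r. dist (Q t s) (cpartial k f (z + s *s axis j 1)) < e"
      using near[of "min d r"] d(1) r(1)
      by (simp, elim eventually_mono) auto
  qed
  moreover have "\<forall>\<^sub>F t in at 0. Q t holomorphic_on ball 0 r"
    using near[OF r(1)]
  proof (rule eventually_mono)
    fix t :: complex assume t: "t \<noteq> 0 \<and> norm t < r"
    show "Q t holomorphic_on ball 0 r"
      unfolding holomorphic_on_open[OF open_ball]
    proof
      fix s :: complex assume "s \<in> ball 0 r"
      with t show "\<exists>D. (Q t has_field_derivative D) (at s)"
        using Q_deriv[of s t] by auto
    qed
  qed
  ultimately have "((\<lambda>t. (deriv ^^ 1) (Q t) 0) \<longlongrightarrow>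
      (deriv ^^ 1) (\<lambda>s. cpartial k f (z + s *s axis j 1)) 0) (at 0)"
    by (rule higher_deriv_complex_uniform_limit) (use r in auto)
  then have "((\<lambda>t. deriv (Q t) 0) \<longlongrightarrow> cpartial j (cpartial k f) z) (at 0)"
    by (simp add: cpartial_def)
  moreover have "\<forall>\<^sub>F t in at 0. deriv (Q t) 0 = (cpartial j f (z + t *s axis k 1) - cpartial j f z) / t"
    using near[OF r(1)]
  proof (rule eventually_mono)
    fix t :: complex assume "t \<noteq> 0 \<and> norm t < r"
    then show "deriv (Q t) 0 = (cpartial j f (z + t *s axis k 1) - cpartial j f z) / t"
      using DERIV_imp_deriv[OF Q_deriv[of 0 t]] r(1) by simp
  qed
  ultimately have "((\<lambda>t. (cpartial j f (z + t *s axis k 1) - cpartial j f z) / t) \<longlongrightarrow>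
      cpartial j (cpartial k f) z) (at 0)"
    by (rule Lim_transform_eventually)
  then have "((\<lambda>t. cpartial j f (z + t *s axis k 1)) has_field_derivative
      cpartial j (cpartial k f) z) (at 0)"
    by (simp add: has_field_derivative_iff)
  then show ?thesis
    using DERIV_imp_deriv unfolding cpartial_def[of k "cpartial j f"] by blast
qed

section \<open>The radial primitive of a closed holomorphic form\<close>

text \<open>
  The integral is differentiated under the integral sign on a ball around \<open>z\<close>, where the
  derivative of the integrand depends continuously on \<open>(x, t)\<close> because the partial derivatives of
  \<open>F\<close> are continuous. Symmetry of these partial derivatives turns the resulting integrand into a
  \<open>t\<close>-derivative, which the fundamental theorem of calculus integrates.
\<close>

lemma has_derivative_radial_integral:
  fixes U :: "(complex ^ 'n) set" and F :: "complex ^ 'n \<Rightarrow> complex ^ 'n"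
  assumes U: "open U" and star: "star_shaped_wrt a U" and F: "F vholomorphic_on U"
    and closed: "\<And>z j k. z \<in> U \<Longrightarrow> cpartial k (\<lambda>w. F w $ j) z = cpartial j (\<lambda>w. F w $ k) z"
    and "z \<in> U"
  shows "((\<lambda>x. integral {0..1} (\<lambda>t. \<Sum>j\<in>UNIV. F (a + t *\<^sub>R (x - a)) $ j * (x - a) $ j))
      has_derivative (\<lambda>v. \<Sum>k\<in>UNIV. v $ k * F z $ k)) (at z)"
proof -
  define p where "p x t = a + t *\<^sub>R (x - a)" for x and t :: real
  define P where "P j k = cpartial k (\<lambda>w. F w $ j)" for j k
  \<comment> \<open>The coefficient of \<open>dx\<^sub>k\<close>, already in the form that symmetry of \<open>P\<close> allows:
      it equals \<open>d/dt (t F\<^sub>k(p x t))\<close>.\<close>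
  define c where "c x t k = F (p x t) $ k + t *\<^sub>R (\<Sum>j\<in>UNIV. (x - a) $ j * P k j (p x t))" for x t k
  define L where "L x t = Blinfun (\<lambda>v. \<Sum>k\<in>UNIV. v $ k * c x t k)" for x t
  have L: "blinfun_apply (L x t) = (\<lambda>v. \<Sum>k\<in>UNIV. v $ k * c x t k)" for x t
    unfolding L_def
    by (intro bounded_linear_Blinfun_apply bounded_linear_sum bounded_linear_mult_const
        bounded_linear_vec_nth)
  obtain r where r: "r > 0" "ball z r \<subseteq> U"
    using U \<open>z \<in> U\<close> by (meson open_contains_ball)
  have pU: "p x t \<in> U" if "x \<in> U" "t \<in> {0..1}" for x t
    using star that unfolding star_shaped_wrt_def p_def by blast
  have Fj: "(\<lambda>w. F w $ j) mholomorphic_on U" for j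
    using F unfolding vholomorphic_on_def by blast
  have contF: "continuous_on U (\<lambda>w. F w $ j)" for j
    using mholomorphic_on_imp_continuous_on[OF Fj] .
  have contP: "continuous_on U (P j k)" for j k
    unfolding P_def by (rule continuous_on_cpartial[OF U Fj])
  have derF: "((\<lambda>w. F w $ j) has_derivative (\<lambda>v. \<Sum>k\<in>UNIV. v $ k * P j k w)) (at w)"
    if "w \<in> U" for j w
    unfolding P_def by (rule mholomorphic_on_has_derivative[OF U Fj that])
  have "((\<lambda>x. integral (cbox 0 1) (\<lambda>t. \<Sum>j\<in>UNIV. F (p x t) $ j * (x - a) $ j))
      has_derivative integral (cbox 0 1) (L z)) (at z within ball z r)"
  proof (rule leibniz_rule)
    fix x t assume "x \<in> ball z r" and t: "t \<in> cbox 0 (1::real)"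
    then have x: "x \<in> U" "p x t \<in> U"
      using r pU by auto
    have "((\<lambda>x. p x t) has_derivative (\<lambda>v. t *\<^sub>R v)) (at x)"
      unfolding p_def by (auto intro!: derivative_eq_intros)
    from has_derivative_compose[OF this derF[OF x(2)]]
    have "((\<lambda>x. F (p x t) $ j) has_derivative (\<lambda>v. \<Sum>k\<in>UNIV. (t *\<^sub>R v) $ k * P j k (p x t))) (at x)"
      for j .
    then have "((\<lambda>x. \<Sum>j\<in>UNIV. F (p x t) $ j * (x - a) $ j) has_derivative
       (\<lambda>v. \<Sum>j\<in>UNIV. F (p x t) $ j * v $ j + (\<Sum>k\<in>UNIV. (t *\<^sub>R v) $ k * P j k (p x t)) * (x - a) $ j)) (at x)"
      by (auto intro!: derivative_eq_intros bounded_linear.has_derivative[OF bounded_linear_vec_nth])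
    moreover have "(\<Sum>j\<in>UNIV. F (p x t) $ j * v $ j + (\<Sum>k\<in>UNIV. (t *\<^sub>R v) $ k * P j k (p x t)) * (x - a) $ j)
       = L x t v" for v
    proof -
      have "(\<Sum>j\<in>UNIV. (\<Sum>k\<in>UNIV. (t *\<^sub>R v) $ k * P j k (p x t)) * (x - a) $ j)
        = (\<Sum>k\<in>UNIV. \<Sum>j\<in>UNIV. (t *\<^sub>R v) $ k * P j k (p x t) * (x - a) $ j)"
        by (subst sum.swap) (simp add: sum_distrib_right)
      \<comment> \<open>Here \<open>P j k\<close> is exchanged for \<open>P k j\<close>.\<close>
      also have "\<dots> = (\<Sum>k\<in>UNIV. v $ k * t *\<^sub>R (\<Sum>j\<in>UNIV. (x - a) $ j * P k j (p x t)))"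
        using closed[OF x(2)]
        by (simp add: P_def sum_distrib_left scaleR_sum_right mult_ac)
      finally show ?thesis
        unfolding L c_def distrib_left sum.distrib by (simp add: mult.commute)
    qed
    ultimately show "((\<lambda>x. \<Sum>j\<in>UNIV. F (p x t) $ j * (x - a) $ j) has_derivative
       blinfun_apply (L x t)) (at x within ball z r)"
      by (simp add: has_derivative_at_withinI)
  next
    fix x assume "x \<in> ball z r"
    then have x: "x \<in> U"
      using r by auto
    have "continuous_on (cbox 0 1) (\<lambda>t. F (p x t) $ j)" for j
      using pU[OF x]
      by (intro continuous_on_compose2[OF contF]) (auto simp: p_def intro!: continuous_intros)
    then show "(\<lambda>t. \<Sum>j\<in>UNIV. F (p x t) $ j * (x - a) $ j) integrable_on cbox 0 1"
      by (intro integrable_continuous continuous_on_sum continuous_on_mult continuous_on_const)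
  next
    have cont_p: "continuous_on (ball z r \<times> cbox 0 1) (\<lambda>y. p (fst y) (snd y))"
      unfolding p_def by (intro continuous_intros)
    have img: "(\<lambda>y. p (fst y) (snd y)) ` (ball z r \<times> cbox 0 1) \<subseteq> U"
      using pU r by auto
    have "continuous_on (ball z r \<times> cbox 0 1) (\<lambda>y. c (fst y) (snd y) k)" for k
      unfolding c_def
      by (intro continuous_intros continuous_on_compose2[OF contF cont_p img]
          continuous_on_compose2[OF contP cont_p img])
    then show "continuous_on (ball z r \<times> cbox 0 1) (\<lambda>(x, t). L x t)"
      unfolding split_beta
      by (intro continuous_on_blinfun_componentwise) (auto simp: L intro!: continuous_intros)
  qed (use r in auto)
  moreover have "blinfun_apply (integral (cbox 0 1) (L z)) = (\<lambda>v. \<Sum>k\<in>UNIV. v $ k * F z $ k)"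
  proof
    fix v
    show "integral (cbox 0 1) (L z) v = (\<Sum>k\<in>UNIV. v $ k * F z $ k)"
    proof -
      have deriv: "((\<lambda>t. t *\<^sub>R F (p z t) $ k) has_vector_derivative c z t k) (at t within {0..1})"
        if "t \<in> {0..1}" for t k
      proof -
        have "((\<lambda>t. p z t) has_derivative (\<lambda>h. h *\<^sub>R (z - a))) (at t within {0..1})"
          unfolding p_def by (auto intro!: derivative_eq_intros)
        from has_derivative_compose[OF this derF[OF pU[OF \<open>z \<in> U\<close> that]]]
        have "((\<lambda>t. F (p z t) $ k) has_vector_derivative (\<Sum>j\<in>UNIV. (z - a) $ j * P k j (p z t)))
            (at t within {0..1})"
          by (simp add: has_vector_derivative_def scaleR_sum_right)
        then show ?thesis
          unfolding c_def by (auto intro!: derivative_eq_intros)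
      qed
      have "((\<lambda>t. \<Sum>k\<in>UNIV. v $ k * c z t k) has_integral
          (\<Sum>k\<in>UNIV. v $ k * (1 *\<^sub>R F (p z 1) $ k - 0 *\<^sub>R F (p z 0) $ k))) {0..1}"
        by (intro has_integral_sum has_integral_mult_right fundamental_theorem_of_calculus deriv) auto
      then have int: "((\<lambda>t. L z t v) has_integral (\<Sum>k\<in>UNIV. v $ k * F z $ k)) (cbox 0 1)"
        by (simp add: p_def L)
      have "continuous_on (cbox 0 1) (\<lambda>t. c z t k)" for k
      proof -
        have cp: "continuous_on (cbox 0 1) (p z)" "p z ` cbox 0 1 \<subseteq> U"
          using pU[OF \<open>z \<in> U\<close>] by (auto simp: p_def intro!: continuous_intros)
        show ?thesis
          unfolding c_def
          by (intro continuous_intros continuous_on_compose2[OF contF cp]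
            continuous_on_compose2[OF contP cp])
      qed
      then have "L z integrable_on cbox 0 1"
        by (intro integrable_continuous continuous_on_blinfun_componentwise)
           (auto simp: L intro!: continuous_intros)
      from integral_linear[OF this, of "\<lambda>l. blinfun_apply l v"]
      show ?thesis
        using integral_unique[OF int] by (simp add: o_def blinfun.bounded_linear_left)
    qed
  qed
  ultimately show ?thesis
    using r by (simp add: p_def at_within_open[of z "ball z r"])
qed

theorem theorem2p2:
  fixes U :: "(complex ^ 'n) set" and a :: "complex ^ 'n"
    and F :: "complex ^ 'n \<Rightarrow> complex ^ 'n"
  assumes "open U" and "a \<in> U" and "star_shaped_wrt a U"
    and "F vholomorphic_on U"
  shows "(\<forall>z\<in>U. \<forall>j k. cpartial k (\<lambda>w. F w $ j) z = cpartial j (\<lambda>w. F w $ k) z)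
    \<longleftrightarrow> (\<exists>g. g mholomorphic_on U \<and> (\<forall>z\<in>U. cdifferential g z = F z) \<and> g a = 0)"
proof
  assume closed: "\<forall>z\<in>U. \<forall>j k. cpartial k (\<lambda>w. F w $ j) z = cpartial j (\<lambda>w. F w $ k) z"
  define g where
    "g x = integral {0..1} (\<lambda>t. \<Sum>j\<in>UNIV. F (a + t *\<^sub>R (x - a)) $ j * (x - a) $ j)" for x
  have g: "(g has_derivative (\<lambda>v. \<Sum>k\<in>UNIV. v $ k * F z $ k)) (at z)" if "z \<in> U" for z
    unfolding g_def
    using closed that by (intro has_derivative_radial_integral[OF assms(1,3,4)]) auto
  have "g mholomorphic_on U"
    using g by (rule mholomorphic_onI)
  moreover have "cdifferential g z = F z" if "z \<in> U" for z
    using cpartial_eqI[OF g[OF that]] by (simp add: cdifferential_def vec_eq_iff)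
  moreover have "g a = 0"
    by (simp add: g_def)
  ultimately show "\<exists>g. g mholomorphic_on U \<and> (\<forall>z\<in>U. cdifferential g z = F z) \<and> g a = 0"
    by blast
next
  assume "\<exists>g. g mholomorphic_on U \<and> (\<forall>z\<in>U. cdifferential g z = F z) \<and> g a = 0"
  then obtain g where g: "g mholomorphic_on U" "\<And>z. z \<in> U \<Longrightarrow> cdifferential g z = F z"
    by blast
  have F_eq: "F w $ j = cpartial j g w" if "w \<in> U" for w j
    using g(2)[OF that] by (metis cdifferential_def vec_lambda_beta)
  have "cpartial k (\<lambda>w. F w $ j) z = cpartial k (cpartial j g) z" if "z \<in> U" for z j k
    using F_eq by (rule cpartial_cong[OF assms(1) that])
  then show "\<forall>z\<in>U. \<forall>j k. cpartial k (\<lambda>w. F w $ j) z = cpartial j (\<lambda>w. F w $ k) z"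
    using cpartial_commute[OF assms(1) g(1)] by simp
qed

end
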